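(* Let $p_{\rm true}\in[0,1]$ be a constant and let $d=d(n)\ge 2$ be integers. Suppose that the input maps $X^{\rm in}(i,j)$ for all $1\le i<j\le n$ are generated according to the random corruption model $$X^{\rm in}(i,j)=z_{ij}I_d+(1-z_{ij})\mathbf{P}_{ij},\qquad 1\le i<j\le n,$$ and assume that $d\in o\big((n/\log n)^{1/4}\big)$. If $p_{\rm true}>0.585$, then the basic LP relaxation (P) recovers the ground truth maps with high probability; that is, the probability that $\bar X$, given by $\bar X(i,j)=I_d$ for all $1\le i<j\le n$, is the unique optimal solution of (P) tends to $1$ as $n\to\infty$.
   Context: Write $[m]=\{1,\dots,m\}$. There are $n\ge 3$ objects, each with $d\ge 2$ elements. In the random corruption model, $I_d$ is the $d\times d$ identity matrix, each $z_{ij}$ is a Bernoulli random variable with $\mathbb{P}(z_{ij}=1)=p_{\rm true}$, each $\mathbf{P}_{ij}$ is a uniformly random $d\times d$ permutation matrix, and all $z_{ij},\mathbf{P}_{ij}$ ($1\le i<j\le n$) are mutually independent. The ground truth is $\bar X(i,j)=I_d$ for all $1\le i<j\le n$. Set $a_{tq}(i,j)=1-2X^{\rm in}_{tq}(i,j)$ for $t,q\in[d]$, $1\le i<j\le n$. The basic LP relaxation (P), in variables $X(i,j)\in\mathbb{R}^{d\times d}$, $1\le i<j\le n$, is: minimize $\sum_{1\le i<j\le n}\sum_{t,q\in[d]}a_{tq}(i,j)X_{tq}(i,j)$ subject to - $\sum_{q\in[d]}X_{tq}(i,j)=1$ for all $t\in[d]$, $1\le i<j\le n$; - $\sum_{t\in[d]}X_{tq}(i,j)=1$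 for all $q\in[d]$, $1\le i<j\le n$; - for all $l,t,q\in[d]$ and $1\le i<j<k\le n$: $X_{lt}(i,j)+X_{tq}(j,k)-X_{lq}(i,k)\le 1$, $X_{lt}(i,j)-X_{tq}(j,k)+X_{lq}(i,k)\le 1$, and $-X_{lt}(i,j)+X_{tq}(j,k)+X_{lq}(i,k)\le 1$; - $X_{tq}(i,j)\ge 0$ for all $t,q\in[d]$, $1\le i<j\le n$. An optimization problem recovers the ground truth if its unique optimal solution is the ground truth. *)

theory Defs
  imports
    "HOL-Probability.Probability"
    "HOL-Combinatorics.Permutations"
    "Jordan_Normal_Form.Matrix"
begin

(* The elements of an object are numbered {0..<d}, following the index range of
   the matrix type, instead of {1..d}. *)

definition object_pairs :: "nat \<Rightarrow> (nat \<times> nat) set" where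
  "object_pairs n = {(i, j). 1 \<le> i \<and> i < j \<and> j \<le> n}"

definition permutation_mats :: "nat \<Rightarrow> real mat set" where
  "permutation_mats d =
     {mat d d (\<lambda>(t, q). if q = \<sigma> t then 1 else 0) | \<sigma>. \<sigma> permutes {..<d}}"

lemma finite_object_pairs: "finite (object_pairs n)"
  by (rule finite_subset[of _ "{1..n} \<times> {1..n}"]) (auto simp: object_pairs_def)

(* pmf_of_set is the uniform distribution only on a finite nonempty set. *)
lemma permutation_mats_finite: "finite (permutation_mats d)"
  and permutation_mats_nonempty: "permutation_mats d \<noteq> {}"
proof -
  have "permutation_mats d =
      (\<lambda>\<sigma>. mat d d (\<lambda>(t, q). if q = \<sigma> t then 1 else 0)) ` {\<sigma>. \<sigma> permutes {..<d}}"
    by (auto simp: permutation_mats_def)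
  then show "finite (permutation_mats d)"
    by (simp add: finite_permutations)
  show "permutation_mats d \<noteq> {}"
    using permutes_id[of "{..<d}"] unfolding permutation_mats_def by blast
qed

(* Joint law of the family of input maps X^in(i,j) = z_ij I_d + (1 - z_ij) P_ij.
   The two product distributions make all z_ij and P_ij mutually independent.
   Values at arguments outside object_pairs n are irrelevant. *)
definition random_corruption ::
    "nat \<Rightarrow> nat \<Rightarrow> real \<Rightarrow> (nat \<times> nat \<Rightarrow> real mat) pmf" where
  "random_corruption n d p =
     map_pmf
       (\<lambda>\<omega> e. case \<omega> e of (z, P) \<Rightarrow>
          of_bool z \<cdot>\<^sub>m 1\<^sub>m d + (1 - of_bool z) \<cdot>\<^sub>m P)
       (Pi_pmf (object_pairs n) undefined
          (\<lambda>_. pair_pmf (bernoulli_pmf p) (pmf_of_set (permutation_mats d))))"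

definition lp_objective ::
    "nat \<Rightarrow> nat \<Rightarrow> (nat \<times> nat \<Rightarrow> real mat) \<Rightarrow> (nat \<times> nat \<Rightarrow> real mat) \<Rightarrow> real" where
  "lp_objective n d Xin X =
     (\<Sum>e\<in>object_pairs n. \<Sum>t<d. \<Sum>q<d. (1 - 2 * (Xin e $$ (t, q))) * (X e $$ (t, q)))"

definition lp_feasible :: "nat \<Rightarrow> nat \<Rightarrow> (nat \<times> nat \<Rightarrow> real mat) \<Rightarrow> bool" where
  "lp_feasible n d X \<longleftrightarrow>
     (\<forall>e\<in>object_pairs n. X e \<in> carrier_mat d d) \<and>
     (\<forall>e\<in>object_pairs n. \<forall>t<d. (\<Sum>q<d. X e $$ (t, q)) = 1) \<and>
     (\<forall>e\<in>object_pairs n. \<forall>q<d. (\<Sum>t<d. X e $$ (t, q)) = 1) \<and>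
     (\<forall>i j k. 1 \<le> i \<and> i < j \<and> j < k \<and> k \<le> n \<longrightarrow>
        (\<forall>l<d. \<forall>t<d. \<forall>q<d.
           X (i, j) $$ (l, t) + X (j, k) $$ (t, q) - X (i, k) $$ (l, q) \<le> 1 \<and>
           X (i, j) $$ (l, t) - X (j, k) $$ (t, q) + X (i, k) $$ (l, q) \<le> 1 \<and>
           - X (i, j) $$ (l, t) + X (j, k) $$ (t, q) + X (i, k) $$ (l, q) \<le> 1)) \<and>
     (\<forall>e\<in>object_pairs n. \<forall>t<d. \<forall>q<d. X e $$ (t, q) \<ge> 0)"

definition lp_optimal ::
    "nat \<Rightarrow> nat \<Rightarrow> (nat \<times> nat \<Rightarrow> real mat) \<Rightarrow> (nat \<times> nat \<Rightarrow> real mat) \<Rightarrow> bool" where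
  "lp_optimal n d Xin X \<longleftrightarrow>
     lp_feasible n d X \<and>
     (\<forall>Y. lp_feasible n d Y \<longrightarrow> lp_objective n d Xin X \<le> lp_objective n d Xin Y)"

definition ground_truth :: "nat \<Rightarrow> nat \<times> nat \<Rightarrow> real mat" where
  "ground_truth d = (\<lambda>_. 1\<^sub>m d)"

(* The variables of the LP are the X (i, j) with 1 \<le> i < j \<le> n only, so solutions
   are identified when they agree on object_pairs n. *)
definition lp_recovers_ground_truth ::
    "nat \<Rightarrow> nat \<Rightarrow> (nat \<times> nat \<Rightarrow> real mat) \<Rightarrow> bool" where
  "lp_recovers_ground_truth n d Xin \<longleftrightarrow>
     lp_optimal n d Xin (ground_truth d) \<and>
     (\<forall>X. lp_optimal n d Xin X \<longrightarrow> (\<forall>e\<in>object_pairs n. X e = ground_truth d e))"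

end

theory Submission
  imports Defs "HOL-Real_Asymp.Real_Asymp"
begin

text \<open>
  For a feasible point \<open>X\<close> call \<open>u\<^sub>t(i, j) = 1 - X\<^sub>t\<^sub>t(i, j)\<close> the defect of element \<open>t\<close> on the pair
  \<open>(i, j)\<close>. The ground truth is the only feasible point without defects, and because the entries of each row
  add up to 1, a defect is also the off-diagonal mass of its row. Up to a constant factor, passing from the ground
  truth to \<open>X\<close> changes the objective by \<open>G - B\<close>. Here \<open>G\<close> sums the defects over all places where the
  input map fixes \<open>t\<close>, and \<open>B\<close> sums the entries \<open>X\<^sub>t\<^sub>q\<close> over all places where the input map sends
  \<open>t\<close> to some \<open>q \<noteq> t\<close> (\<open>objective_gap\<close>). So it has to be shown that \<open>B < G\<close>, unless \<open>X\<close> has no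
  defects.

  Extending all maps to ordered pairs by transposition turns the three constraints on each triple into one,
  and two of its instances carry the proof:
  \<open>u\<^sub>t(i, j) \<le> u\<^sub>t(i, k) + u\<^sub>t(k, j)\<close> and \<open>X\<^sub>t\<^sub>q(i, j) \<le> X\<^sub>t\<^sub>q(i, k) + u\<^sub>q(j, k)\<close>.
  An input map fixes a given element with probability \<open>g = p + r\<close> and sends it to a given other element with
  probability \<open>r = (1 - p) / d\<close>. Averaging the first inequality over the \<open>k\<close> for which the inputs on
  \<open>(i, k)\<close> and \<open>(k, j)\<close> both fix \<open>t\<close> bounds the sum \<open>T\<close> of all defects by \<open>2 G / g\<close>
  (\<open>total_defect_le_agreeing\<close>). Averaging the second over the \<open>k\<close> for which the input on \<open>(j, k)\<close> fixes
  \<open>q\<close> gives \<open>g B \<le> r g T + (1 - g) G\<close> (\<open>corrupted_mass_le_defects\<close>). Together,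
  \<open>g B \<le> (2 r + 1 - g) G\<close>, and \<open>2 r + 1 - g < g\<close> says \<open>p > 1 / 2\<close>
  (\<open>agreement_dominates_corruption\<close>).

  This used the expected values of the numbers of suitable \<open>k\<close>. Each of these numbers is a sum of \<open>n - 2\<close>
  independent indicators, so by Hoeffding's inequality it is off by \<open>\<epsilon> (n - 2)\<close> or more with
  probability at most \<open>2 exp (-2 \<epsilon>\<^sup>2 (n - 2))\<close> (\<open>random_counts_concentrate\<close>). There are at most
  \<open>2 n\<^sup>2 d\<^sup>2\<close> such numbers, which is polynomial in \<open>n\<close>, so with probability tending to 1 all of them are
  close enough to their expectations.
\<close>

section \<open>Sums over distinct pairs and triples\<close>

lemma sum_distinct_pairs_swap:
  fixes f :: "'v \<Rightarrow> 'v \<Rightarrow> real"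
  assumes "finite V"
  shows "(\<Sum>i\<in>V. \<Sum>j\<in>V - {i}. f i j) = (\<Sum>i\<in>V. \<Sum>j\<in>V - {i}. f j i)"
proof -
  have *: "V - {i} = {j \<in> V. i \<noteq> j}" "V - {i} = {j \<in> V. j \<noteq> i}" for i
    by auto
  have "(\<Sum>i\<in>V. \<Sum>j\<in>V - {i}. f i j) = (\<Sum>j\<in>V. \<Sum>i\<in>{i\<in>V. i \<noteq> j}. f i j)"
    unfolding *(1) by (rule sum.swap_restrict) (use assms in auto)
  then show ?thesis
    unfolding *(2)[symmetric] .
qed

lemma sum_distinct_triples_swap:
  fixes f :: "'v \<Rightarrow> 'v \<Rightarrow> 'v \<Rightarrow> real"
  assumes "finite V"
  shows "(\<Sum>i\<in>V. \<Sum>j\<in>V - {i}. \<Sum>k\<in>V - {i, j}. f i j k)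
       = (\<Sum>i\<in>V. \<Sum>k\<in>V - {i}. \<Sum>j\<in>V - {i, k}. f i j k)"
proof (rule sum.cong[OF refl])
  fix i assume "i \<in> V"
  have *: "V - {i, j} = (V - {i}) - {j}" for j
    by auto
  show "(\<Sum>j\<in>V - {i}. \<Sum>k\<in>V - {i, j}. f i j k)
      = (\<Sum>k\<in>V - {i}. \<Sum>j\<in>V - {i, k}. f i j k)"
    unfolding * by (rule sum_distinct_pairs_swap) (use assms in auto)
qed

lemma sum_distinct_triples_rotate:
  fixes f :: "'v \<Rightarrow> 'v \<Rightarrow> 'v \<Rightarrow> real"
  assumes "finite V"
  shows "(\<Sum>i\<in>V. \<Sum>j\<in>V - {i}. \<Sum>k\<in>V - {i, j}. f i j k)
       = (\<Sum>j\<in>V. \<Sum>k\<in>V - {j}. \<Sum>i\<in>V - {j, k}. f i j k)"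
proof -
  have "(\<Sum>i\<in>V. \<Sum>j\<in>V - {i}. \<Sum>k\<in>V - {i, j}. f i j k)
      = (\<Sum>j\<in>V. \<Sum>i\<in>V - {j}. \<Sum>k\<in>V - {i, j}. f i j k)"
    by (rule sum_distinct_pairs_swap[OF assms])
  also have "\<dots> = (\<Sum>j\<in>V. \<Sum>i\<in>V - {j}. \<Sum>k\<in>V - {j, i}. f i j k)"
    by (simp add: insert_commute)
  also have "\<dots> = (\<Sum>j\<in>V. \<Sum>k\<in>V - {j}. \<Sum>i\<in>V - {j, k}. f i j k)"
    by (rule sum_distinct_triples_swap[OF assms])
  finally show ?thesis .
qed

section \<open>Averaging the cycle constraints\<close>

text \<open>\<open>M\<close> is the input and \<open>Y\<close> a feasible point, both written on ordered pairs of objects. On ordered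
  pairs the three families of triangle constraints are the single assumption \<open>Y_cycle\<close>: which of the
  three terms carries the minus sign is decided by the orientation.\<close>

locale map_pair =
  fixes V :: "'v set" and d :: nat and M Y :: "'v \<Rightarrow> 'v \<Rightarrow> nat \<Rightarrow> nat \<Rightarrow> real"
  assumes finite_V: "finite V"
    and M_nonneg: "\<And>i j t q. \<lbrakk>i \<in> V; j \<in> V; i \<noteq> j; t < d; q < d\<rbrakk> \<Longrightarrow> M i j t q \<ge> 0"
    and M_sym: "\<And>i j t q. \<lbrakk>i \<in> V; j \<in> V; i \<noteq> j\<rbrakk> \<Longrightarrow> M i j t q = M j i q t"
    and M_row: "\<And>i j t. \<lbrakk>i \<in> V; j \<in> V; i \<noteq> j; t < d\<rbrakk> \<Longrightarrow> (\<Sum>q<d. M i j t q) = 1"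
    and Y_nonneg: "\<And>i j t q. \<lbrakk>i \<in> V; j \<in> V; i \<noteq> j; t < d; q < d\<rbrakk> \<Longrightarrow> Y i j t q \<ge> 0"
    and Y_row: "\<And>i j t. \<lbrakk>i \<in> V; j \<in> V; i \<noteq> j; t < d\<rbrakk> \<Longrightarrow> (\<Sum>q<d. Y i j t q) = 1"
    and Y_cycle: "\<And>i j k l t q. \<lbrakk>i \<in> V; j \<in> V; k \<in> V; distinct [i, j, k]; l < d; t < d; q < d\<rbrakk>
      \<Longrightarrow> Y i j l t + Y j k t q - Y i k l q \<le> 1"
begin

text \<open>Under \<open>Y_cycle\<close> the defect of a fixed element \<open>t\<close> obeys the triangle inequality along objects;
  this is the reason for working with \<open>1 - Y i j t t\<close>.\<close>

definition defect :: "'v \<Rightarrow> 'v \<Rightarrow> nat \<Rightarrow> real" where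
  "defect i j t = 1 - Y i j t t"

definition total_defect :: real where
  "total_defect = (\<Sum>i\<in>V. \<Sum>j\<in>V - {i}. \<Sum>t<d. defect i j t)"

text \<open>The two sums below are what a point of the linear program loses and gains in comparison with the
  ground truth: it loses wherever the input fixes an element, even if it does so by
  chance in a corrupted map, and it gains wherever the input moves an element \<open>t\<close> to \<open>q\<close>.\<close>

definition agreeing_defect :: real where
  "agreeing_defect = (\<Sum>i\<in>V. \<Sum>j\<in>V - {i}. \<Sum>t<d. M i j t t * defect i j t)"

definition corrupted_mass :: real where
  "corrupted_mass =
     (\<Sum>i\<in>V. \<Sum>j\<in>V - {i}. \<Sum>t<d. \<Sum>q\<in>{..<d} - {t}. M i j t q * Y i j t q)"

lemma defect_eq_offdiagonal:
  assumes "i \<in> V" "j \<in> V" "i \<noteq> j" "t < d"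
  shows "defect i j t = (\<Sum>q\<in>{..<d} - {t}. Y i j t q)"
  using Y_row[OF assms] assms(4) sum.remove[of "{..<d}" t "Y i j t"]
  by (simp add: defect_def)

lemma defect_nonneg:
  assumes "i \<in> V" "j \<in> V" "i \<noteq> j" "t < d"
  shows "defect i j t \<ge> 0"
  unfolding defect_eq_offdiagonal[OF assms]
  by (rule sum_nonneg) (use assms Y_nonneg in auto)

lemma agreeing_defect_nonneg: "agreeing_defect \<ge> 0"
  unfolding agreeing_defect_def
  by (intro sum_nonneg mult_nonneg_nonneg M_nonneg defect_nonneg) auto

lemma total_defect_zeroD:
  assumes "total_defect \<le> 0" "i \<in> V" "j \<in> V" "i \<noteq> j" "t < d"
  shows "defect i j t = 0"
proof -
  have nn: "\<And>i j. i \<in> V \<Longrightarrow> j \<in> V - {i} \<Longrightarrow> (\<Sum>t<d. defect i j t) \<ge> 0"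
    by (intro sum_nonneg defect_nonneg) auto
  have nn': "\<And>i. i \<in> V \<Longrightarrow> (\<Sum>j\<in>V - {i}. \<Sum>t<d. defect i j t) \<ge> 0"
    by (intro sum_nonneg nn) auto
  have "total_defect = 0"
    using assms(1) nn' by (simp add: total_defect_def antisym sum_nonneg)
  then have "\<forall>i\<in>V. (\<Sum>j\<in>V - {i}. \<Sum>t<d. defect i j t) = 0"
    using sum_nonneg_eq_0_iff[OF finite_V nn'] by (simp add: total_defect_def)
  then have "\<forall>j\<in>V - {i}. (\<Sum>t<d. defect i j t) = 0"
    using sum_nonneg_eq_0_iff[of "V - {i}" "\<lambda>j. \<Sum>t<d. defect i j t"] nn finite_V assms(2)
    by simp
  then show ?thesis
    using sum_nonneg_eq_0_iff[of "{..<d}" "defect i j"] defect_nonneg assms by simp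
qed

text \<open>The defect of \<open>(i, j)\<close> is at most the sum of the defects along any detour \<open>i, k, j\<close>. Averaging over the
  detours on which the input fixes \<open>t\<close> twice, every pair is charged only to pairs that count in
  \<open>agreeing_defect\<close>, and no such pair is charged more often than its endpoints have agreeing
  neighbours.\<close>

lemma total_defect_le_agreeing:
  assumes two_paths: "\<And>i j t. \<lbrakk>i \<in> V; j \<in> V; i \<noteq> j; t < d\<rbrakk>
      \<Longrightarrow> a \<le> (\<Sum>k\<in>V - {i, j}. M i k t t * M k j t t)"
    and degree: "\<And>i j t. \<lbrakk>i \<in> V; j \<in> V; i \<noteq> j; t < d\<rbrakk>
      \<Longrightarrow> (\<Sum>k\<in>V - {i, j}. M j k t t) \<le> b"
  shows "a * total_defect \<le> 2 * b * agreeing_defect"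
proof -
  let ?P = "\<lambda>i k j. \<Sum>t<d. M i k t t * M k j t t * defect i k t"
  let ?Q = "\<lambda>i k j. \<Sum>t<d. M i k t t * M k j t t * defect k j t"
  have "a * total_defect \<le> (\<Sum>i\<in>V. \<Sum>j\<in>V - {i}. \<Sum>t<d.
      (\<Sum>k\<in>V - {i, j}. M i k t t * M k j t t) * defect i j t)"
    unfolding total_defect_def sum_distrib_left
    by (intro sum_mono mult_right_mono two_paths defect_nonneg) auto
  also have "\<dots> \<le> (\<Sum>i\<in>V. \<Sum>j\<in>V - {i}. \<Sum>t<d.
      (\<Sum>k\<in>V - {i, j}. M i k t t * M k j t t * (defect i k t + defect k j t)))"
    unfolding sum_distrib_right
  proof (intro sum_mono mult_left_mono)
    fix i j t k assume *: "i \<in> V" "j \<in> V - {i}" "t \<in> {..<d}" "k \<in> V - {i, j}"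
    then show "defect i j t \<le> defect i k t + defect k j t"
      using Y_cycle[of i k j t t t] by (auto simp: defect_def)
    show "0 \<le> M i k t t * M k j t t"
      using * by (intro mult_nonneg_nonneg M_nonneg) auto
  qed
  also have "\<dots> = (\<Sum>i\<in>V. \<Sum>j\<in>V - {i}. \<Sum>k\<in>V - {i, j}. ?P i k j)
                + (\<Sum>i\<in>V. \<Sum>j\<in>V - {i}. \<Sum>k\<in>V - {i, j}. ?Q i k j)"
    unfolding sum.distrib[symmetric]
    by (intro sum.cong refl, subst sum.swap)
       (intro sum.cong refl, simp add: sum.distrib[symmetric] algebra_simps)
  also have "(\<Sum>i\<in>V. \<Sum>j\<in>V - {i}. \<Sum>k\<in>V - {i, j}. ?P i k j) \<le> b * agreeing_defect"
  proof -
    have "(\<Sum>i\<in>V. \<Sum>j\<in>V - {i}. \<Sum>k\<in>V - {i, j}. ?P i k j)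
        = (\<Sum>i\<in>V. \<Sum>k\<in>V - {i}. \<Sum>j\<in>V - {i, k}. ?P i k j)"
      by (rule sum_distinct_triples_swap[OF finite_V])
    also have "\<dots> = (\<Sum>i\<in>V. \<Sum>k\<in>V - {i}. \<Sum>t<d.
        (M i k t t * defect i k t) * (\<Sum>j\<in>V - {i, k}. M k j t t))"
      by (intro sum.cong refl, subst sum.swap)
         (intro sum.cong refl, simp add: sum_distrib_left algebra_simps)
    also have "\<dots> \<le> (\<Sum>i\<in>V. \<Sum>k\<in>V - {i}. \<Sum>t<d. (M i k t t * defect i k t) * b)"
      by (intro sum_mono mult_left_mono degree mult_nonneg_nonneg M_nonneg defect_nonneg) auto
    finally show ?thesis
      by (simp add: agreeing_defect_def sum_distrib_left mult.commute)
  qed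
  also have "(\<Sum>i\<in>V. \<Sum>j\<in>V - {i}. \<Sum>k\<in>V - {i, j}. ?Q i k j) \<le> b * agreeing_defect"
  proof -
    have "(\<Sum>i\<in>V. \<Sum>j\<in>V - {i}. \<Sum>k\<in>V - {i, j}. ?Q i k j)
        = (\<Sum>j\<in>V. \<Sum>k\<in>V - {j}. \<Sum>i\<in>V - {j, k}. ?Q i k j)"
      by (rule sum_distinct_triples_rotate[OF finite_V])
    also have "\<dots> = (\<Sum>k\<in>V. \<Sum>j\<in>V - {k}. \<Sum>i\<in>V - {j, k}. ?Q i k j)"
      by (rule sum_distinct_pairs_swap[OF finite_V])
    also have "\<dots> = (\<Sum>k\<in>V. \<Sum>j\<in>V - {k}. \<Sum>t<d.
        (M k j t t * defect k j t) * (\<Sum>i\<in>V - {j, k}. M k i t t))"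
      by (intro sum.cong refl, subst sum.swap)
         (intro sum.cong refl, auto simp: sum_distrib_left mult_ac intro!: sum.cong M_sym)
    also have "\<dots> \<le> (\<Sum>k\<in>V. \<Sum>j\<in>V - {k}. \<Sum>t<d. (M k j t t * defect k j t) * b)"
      by (intro sum_mono mult_left_mono degree mult_nonneg_nonneg M_nonneg defect_nonneg) auto
    finally show ?thesis
      by (simp add: agreeing_defect_def sum_distrib_left mult.commute)
  qed
  finally show ?thesis
    by simp
qed

text \<open>If the input moves \<open>t\<close> to \<open>q\<close> on \<open>(i, j)\<close>, then following \<open>(j, k)\<close> on an agreeing pair gives
  \<open>Y i j t q \<le> Y i k t q + defect j k q\<close>. The defect term is paid by agreeing pairs. The other term is
  where randomness of the corrupted maps helps: an entry \<open>Y i k t q\<close> with \<open>t \<noteq> q\<close> is charged only by those \<open>j\<close>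
  whose corrupted map moves \<open>t\<close> to exactly this \<open>q\<close>, about one in \<open>d\<close> of the corrupted maps.\<close>

lemma corrupted_mass_le_defects:
  assumes degree: "\<And>i j q. \<lbrakk>i \<in> V; j \<in> V; i \<noteq> j; q < d\<rbrakk>
      \<Longrightarrow> c \<le> (\<Sum>k\<in>V - {i, j}. M j k q q)"
    and paths: "\<And>i j t q. \<lbrakk>i \<in> V; j \<in> V; i \<noteq> j; t < d; q < d; t \<noteq> q\<rbrakk>
      \<Longrightarrow> (\<Sum>k\<in>V - {i, j}. M i k t q * M k j q q) \<le> e"
  shows "c * corrupted_mass \<le> e * total_defect + (real (card V) - 2 - c) * agreeing_defect"
proof -
  let ?P = "\<lambda>i j k. \<Sum>t<d. \<Sum>q\<in>{..<d} - {t}. M i j t q * M j k q q * Y i k t q"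
  let ?Q = "\<lambda>i j k. \<Sum>t<d. \<Sum>q\<in>{..<d} - {t}. M i j t q * M j k q q * defect j k q"
  have "c * corrupted_mass \<le> (\<Sum>i\<in>V. \<Sum>j\<in>V - {i}. \<Sum>t<d. \<Sum>q\<in>{..<d} - {t}.
      (\<Sum>k\<in>V - {i, j}. M j k q q) * (M i j t q * Y i j t q))"
    unfolding corrupted_mass_def sum_distrib_left
    by (intro sum_mono mult_right_mono degree mult_nonneg_nonneg M_nonneg Y_nonneg) auto
  also have "\<dots> \<le> (\<Sum>i\<in>V. \<Sum>j\<in>V - {i}. \<Sum>t<d. \<Sum>q\<in>{..<d} - {t}. \<Sum>k\<in>V - {i, j}.
      M i j t q * M j k q q * (Y i k t q + defect j k q))"
    unfolding sum_distrib_right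
  proof (intro sum_mono)
    fix i j t q k
    assume *: "i \<in> V" "j \<in> V - {i}" "t \<in> {..<d}" "q \<in> {..<d} - {t}" "k \<in> V - {i, j}"
    have "Y i j t q \<le> Y i k t q + defect j k q"
      using * Y_cycle[of i j k t q q] by (auto simp: defect_def)
    moreover have "0 \<le> M i j t q * M j k q q"
      using * by (intro mult_nonneg_nonneg M_nonneg) auto
    ultimately have "M i j t q * M j k q q * Y i j t q
        \<le> M i j t q * M j k q q * (Y i k t q + defect j k q)"
      by (rule mult_left_mono)
    then show "M j k q q * (M i j t q * Y i j t q)
        \<le> M i j t q * M j k q q * (Y i k t q + defect j k q)"
      by (simp add: mult_ac)
  qed
  also have "\<dots> = (\<Sum>i\<in>V. \<Sum>j\<in>V - {i}. \<Sum>k\<in>V - {i, j}. \<Sum>t<d. \<Sum>q\<in>{..<d} - {t}.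
      M i j t q * M j k q q * (Y i k t q + defect j k q))"
    by (intro sum.cong refl, subst (2) sum.swap, intro sum.cong refl, subst sum.swap) simp
  also have "\<dots> = (\<Sum>i\<in>V. \<Sum>j\<in>V - {i}. \<Sum>k\<in>V - {i, j}. ?P i j k)
                + (\<Sum>i\<in>V. \<Sum>j\<in>V - {i}. \<Sum>k\<in>V - {i, j}. ?Q i j k)"
    by (simp add: sum.distrib distrib_left)
  also have "(\<Sum>i\<in>V. \<Sum>j\<in>V - {i}. \<Sum>k\<in>V - {i, j}. ?P i j k) \<le> e * total_defect"
  proof -
    have "(\<Sum>i\<in>V. \<Sum>j\<in>V - {i}. \<Sum>k\<in>V - {i, j}. ?P i j k)
        = (\<Sum>i\<in>V. \<Sum>k\<in>V - {i}. \<Sum>j\<in>V - {i, k}. ?P i j k)"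
      by (rule sum_distinct_triples_swap[OF finite_V])
    also have "\<dots> = (\<Sum>i\<in>V. \<Sum>k\<in>V - {i}. \<Sum>t<d. \<Sum>q\<in>{..<d} - {t}.
        (\<Sum>j\<in>V - {i, k}. M i j t q * M j k q q) * Y i k t q)"
      unfolding sum_distrib_right
      by (intro sum.cong refl, subst sum.swap, intro sum.cong refl, rule sum.swap)
    also have "\<dots> \<le> (\<Sum>i\<in>V. \<Sum>k\<in>V - {i}. \<Sum>t<d. \<Sum>q\<in>{..<d} - {t}. e * Y i k t q)"
      by (intro sum_mono mult_right_mono paths Y_nonneg) auto
    also have "\<dots> = e * total_defect"
      unfolding total_defect_def sum_distrib_left
      by (intro sum.cong refl, subst defect_eq_offdiagonal) (auto simp: sum_distrib_left)
    finally show ?thesis .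
  qed
  also have "(\<Sum>i\<in>V. \<Sum>j\<in>V - {i}. \<Sum>k\<in>V - {i, j}. ?Q i j k)
      \<le> (real (card V) - 2 - c) * agreeing_defect"
  proof -
    have col: "(\<Sum>t\<in>{..<d} - {q}. M i j t q) = 1 - M j i q q"
      if "i \<in> V" "j \<in> V" "i \<noteq> j" "q < d" for i j q
    proof -
      have "(\<Sum>t\<in>{..<d} - {q}. M i j t q) = (\<Sum>t\<in>{..<d} - {q}. M j i q t)"
        using that by (intro sum.cong M_sym refl)
      also have "\<dots> = 1 - M j i q q"
        using M_row[of j i q] that sum.remove[of "{..<d}" q "M j i q"] by simp
      finally show ?thesis .
    qed
    have "(\<Sum>i\<in>V. \<Sum>j\<in>V - {i}. \<Sum>k\<in>V - {i, j}. ?Q i j k)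
        = (\<Sum>j\<in>V. \<Sum>k\<in>V - {j}. \<Sum>i\<in>V - {j, k}. ?Q i j k)"
      by (rule sum_distinct_triples_rotate[OF finite_V])
    also have "\<dots> = (\<Sum>j\<in>V. \<Sum>k\<in>V - {j}. \<Sum>i\<in>V - {j, k}. \<Sum>q<d.
        \<Sum>t\<in>{..<d} - {q}. M i j t q * M j k q q * defect j k q)"
      by (intro sum.cong refl sum_distinct_pairs_swap) auto
    also have "\<dots> = (\<Sum>j\<in>V. \<Sum>k\<in>V - {j}. \<Sum>q<d.
        (\<Sum>i\<in>V - {j, k}. 1 - M j i q q) * (M j k q q * defect j k q))"
      unfolding sum_distrib_right
      by (intro sum.cong refl, subst sum.swap, intro sum.cong refl, subst col[symmetric])
         (auto simp: sum_distrib_right mult.assoc)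
    also have "\<dots> \<le> (\<Sum>j\<in>V. \<Sum>k\<in>V - {j}. \<Sum>q<d.
        (real (card V) - 2 - c) * (M j k q q * defect j k q))"
    proof (intro sum_mono mult_right_mono mult_nonneg_nonneg M_nonneg defect_nonneg)
      fix j k q assume *: "j \<in> V" "k \<in> V - {j}" "q \<in> {..<d}"
      have "card {j, k} \<le> card V"
        using * by (intro card_mono finite_V) auto
      then have "real (card (V - {j, k})) = real (card V) - 2"
        using * by (subst card_Diff_subset) (auto simp: of_nat_diff)
      moreover have "c \<le> (\<Sum>i\<in>V - {j, k}. M j i q q)"
        using degree[of k j q] * by (simp add: insert_commute)
      ultimately show "(\<Sum>i\<in>V - {j, k}. 1 - M j i q q) \<le> real (card V) - 2 - c"
        by (simp add: sum_subtractf)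
    qed auto
    also have "\<dots> = (real (card V) - 2 - c) * agreeing_defect"
      by (simp add: agreeing_defect_def sum_distrib_left)
    finally show ?thesis .
  qed
  finally show ?thesis
    by simp
qed

text \<open>With \<open>T\<close>, \<open>G\<close>, \<open>B\<close> for the three sums and error-free counts, the two averaging bounds read
  \<open>g T \<le> 2 G\<close> and \<open>g B \<le> r g T + (1 - g) G\<close>, so \<open>g B \<le> (2 r + 1 - g) G\<close>. Since \<open>g = p + r\<close>, the factor
  on the right is smaller than \<open>g\<close> exactly when \<open>1 < 2 p\<close>; the slack \<open>2 p - 1\<close> does not depend on \<open>r\<close>,
  hence not on \<open>d\<close>, and absorbs errors in the counts up to a fixed fraction of \<open>N\<close>. The second
  conclusion is the equality case, from which uniqueness of the optimum follows.\<close>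

lemma agreement_dominates_corruption:
  fixes p r \<epsilon> :: real
  defines "N \<equiv> real (card V) - 2" and "g \<equiv> p + r"
  assumes p: "1 / 2 < p" and r: "0 \<le> r" and g_le: "p + r \<le> 1" and eps: "\<epsilon> = (2 * p - 1) / 20"
    and N: "N > 0"
    and degree: "\<And>i j q. \<lbrakk>i \<in> V; j \<in> V; i \<noteq> j; q < d\<rbrakk>
      \<Longrightarrow> \<bar>(\<Sum>k\<in>V - {i, j}. M j k q q) - N * g\<bar> \<le> \<epsilon> * N"
    and paths: "\<And>i j t q. \<lbrakk>i \<in> V; j \<in> V; i \<noteq> j; t < d; q < d\<rbrakk>
      \<Longrightarrow> \<bar>(\<Sum>k\<in>V - {i, j}. M i k t q * M k j q q) - N * ((if t = q then g else r) * g)\<bar> \<le> \<epsilon> * N"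
  shows "corrupted_mass \<le> agreeing_defect"
    and "agreeing_defect \<le> corrupted_mass \<Longrightarrow> total_defect \<le> 0"
proof -
  let ?T = total_defect and ?G = agreeing_defect and ?B = corrupted_mass
  have G: "0 \<le> ?G"
    by (rule agreeing_defect_nonneg)
  have g: "1 / 2 < g" "g \<le> 1"
    using p r g_le by (auto simp: g_def)
  have e: "0 < \<epsilon>" "\<epsilon> \<le> 1 / 20"
    using p r g_le eps by auto
  have gg: "1 / 4 < g * g" "g * g \<le> 1"
    using mult_strict_mono[of "1/2" g "1/2" g] mult_mono[of g 1 g 1] g by auto
  have "(N * (g * g) - \<epsilon> * N) * ?T \<le> 2 * (N * g + \<epsilon> * N) * ?G"
  proof (rule total_defect_le_agreeing)
    fix i j t assume "i \<in> V" "j \<in> V" "i \<noteq> j" "t < d"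
    then show "N * (g * g) - \<epsilon> * N \<le> (\<Sum>k\<in>V - {i, j}. M i k t t * M k j t t)"
      "(\<Sum>k\<in>V - {i, j}. M j k t t) \<le> N * g + \<epsilon> * N"
      using paths[of i j t t] degree[of i j t] by auto
  qed
  then have "N * ((g * g - \<epsilon>) * ?T) \<le> N * (2 * (g + \<epsilon>) * ?G)"
    by (simp add: algebra_simps)
  then have T: "(g * g - \<epsilon>) * ?T \<le> 2 * (g + \<epsilon>) * ?G"
    using N by simp
  have "(N * g - \<epsilon> * N) * ?B
      \<le> (N * (r * g) + \<epsilon> * N) * ?T + (real (card V) - 2 - (N * g - \<epsilon> * N)) * ?G"
  proof (rule corrupted_mass_le_defects)
    fix i j q assume "i \<in> V" "j \<in> V" "i \<noteq> j" "q < d"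
    then show "N * g - \<epsilon> * N \<le> (\<Sum>k\<in>V - {i, j}. M j k q q)"
      using degree[of i j q] by auto
  next
    fix i j t q assume "i \<in> V" "j \<in> V" "i \<noteq> j" "t < d" "q < d" "t \<noteq> q"
    then show "(\<Sum>k\<in>V - {i, j}. M i k t q * M k j q q) \<le> N * (r * g) + \<epsilon> * N"
      using paths[of i j t q] by auto
  qed
  then have "N * ((g - \<epsilon>) * ?B) \<le> N * ((r * g + \<epsilon>) * ?T + (1 - g + \<epsilon>) * ?G)"
    by (simp add: N_def[symmetric] algebra_simps)
  then have B: "(g - \<epsilon>) * ?B \<le> (r * g + \<epsilon>) * ?T + (1 - g + \<epsilon>) * ?G"
    using N by simp
  have pos: "0 < g * g - \<epsilon>" "0 < g - \<epsilon>"
    using g gg e by auto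
  \<comment> \<open>The slack of the two combined bounds. Without errors it is \<open>(2 g - 2 r - 1) g\<^sup>2 = 20 \<epsilon> g\<^sup>2\<close>, which exceeds the error terms.\<close>
  have key: "2 * (r * g + \<epsilon>) * (g + \<epsilon>) + (1 - g + \<epsilon>) * (g * g - \<epsilon>) < (g - \<epsilon>) * (g * g - \<epsilon>)"
  proof -
    have "(g - \<epsilon>) * (g * g - \<epsilon>) - (2 * (r * g + \<epsilon>) * (g + \<epsilon>) + (1 - g + \<epsilon>) * (g * g - \<epsilon>))
       = (2 * g - 2 * r - 1) * (g * g) - \<epsilon> * (2 * (r * g) + 4 * g - 1 + 2 * (g * g))"
      by (simp add: algebra_simps)
    also have "2 * g - 2 * r - 1 = 20 * \<epsilon>"
      by (simp add: g_def eps)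
    finally have eq: "(g - \<epsilon>) * (g * g - \<epsilon>) - (2 * (r * g + \<epsilon>) * (g + \<epsilon>) + (1 - g + \<epsilon>) * (g * g - \<epsilon>))
       = \<epsilon> * g * (18 * g - 2 * r - 4) + \<epsilon>"
      by (simp add: algebra_simps)
    have "0 < 18 * g - 2 * r - 4"
      using p r g_le g by (simp add: g_def)
    then have "0 < \<epsilon> * g * (18 * g - 2 * r - 4) + \<epsilon>"
      using e g by (intro add_pos_pos mult_pos_pos) auto
    then show ?thesis
      using eq by simp
  qed
  have "(g * g - \<epsilon>) * ((g - \<epsilon>) * ?B)
      \<le> (r * g + \<epsilon>) * ((g * g - \<epsilon>) * ?T) + (g * g - \<epsilon>) * ((1 - g + \<epsilon>) * ?G)"
    using mult_left_mono[OF B, of "g * g - \<epsilon>"] pos by (simp add: algebra_simps)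
  also have "(r * g + \<epsilon>) * ((g * g - \<epsilon>) * ?T) \<le> (r * g + \<epsilon>) * (2 * (g + \<epsilon>) * ?G)"
    using r g e by (intro mult_left_mono[OF T]) auto
  finally have main: "(g - \<epsilon>) * (g * g - \<epsilon>) * ?B
      \<le> (2 * (r * g + \<epsilon>) * (g + \<epsilon>) + (1 - g + \<epsilon>) * (g * g - \<epsilon>)) * ?G"
    by (simp add: algebra_simps)
  have less: "?B < ?G" if "?G > 0"
  proof -
    have "(g - \<epsilon>) * (g * g - \<epsilon>) * ?B < (g - \<epsilon>) * (g * g - \<epsilon>) * ?G"
      using main mult_strict_right_mono[OF key that] by linarith
    moreover have "0 < (g - \<epsilon>) * (g * g - \<epsilon>)"
      using pos by simp
    ultimately show ?thesis
      by (simp add: mult_less_cancel_left_pos)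
  qed
  have le0: "?B \<le> 0" if "?G = 0"
    using main pos that by (simp add: mult_le_0_iff)
  show "?B \<le> ?G"
    using G less le0 by (cases "?G = 0") auto
  show "?T \<le> 0" if "?G \<le> ?B"
  proof -
    have "?G = 0"
      using that less G by fastforce
    then show ?thesis
      using T pos by (simp add: mult_le_0_iff)
  qed
qed

end

section \<open>From counts to recovery by the linear program\<close>

text \<open>The map from \<open>j\<close> to \<open>i\<close> is the transpose of the map from \<open>i\<close> to \<open>j\<close>, which is the inverse if the map
  is a permutation.\<close>

definition oriented :: "(nat \<times> nat \<Rightarrow> real mat) \<Rightarrow> nat \<Rightarrow> nat \<Rightarrow> nat \<Rightarrow> nat \<Rightarrow> real" where
  "oriented X i j t q = (if i < j then X (i, j) $$ (t, q) else X (j, i) $$ (q, t))"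

lemma oriented_sym: "i \<noteq> j \<Longrightarrow> oriented X i j t q = oriented X j i q t"
  by (auto simp: oriented_def)

lemma sum_distinct_pairs_eq_object_pairs:
  fixes f :: "nat \<Rightarrow> nat \<Rightarrow> real"
  assumes "\<And>i j. i \<noteq> j \<Longrightarrow> f i j = f j i"
  shows "(\<Sum>i\<in>{1..n}. \<Sum>j\<in>{1..n} - {i}. f i j) = 2 * (\<Sum>(i, j)\<in>object_pairs n. f i j)"
proof -
  let ?S = "prod.swap ` object_pairs n"
  have "(\<Sum>i\<in>{1..n}. \<Sum>j\<in>{1..n} - {i}. f i j)
      = (\<Sum>(i, j)\<in>(SIGMA i:{1..n}. {1..n} - {i}). f i j)"
    by (rule sum.Sigma) auto
  also have "(SIGMA i:{1..n}. {1..n} - {i}) = object_pairs n \<union> ?S"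
    by (auto simp: object_pairs_def image_iff)
  also have "(\<Sum>(i, j)\<in>object_pairs n \<union> ?S. f i j)
      = (\<Sum>(i, j)\<in>object_pairs n. f i j) + (\<Sum>(i, j)\<in>?S. f i j)"
    by (rule sum.union_disjoint) (auto simp: finite_object_pairs, auto simp: object_pairs_def)
  also have "(\<Sum>(i, j)\<in>?S. f i j) = (\<Sum>(i, j)\<in>object_pairs n. f j i)"
    by (subst sum.reindex) (auto simp: case_prod_unfold)
  also have "\<dots> = (\<Sum>(i, j)\<in>object_pairs n. f i j)"
    by (rule sum.cong) (auto simp: object_pairs_def intro!: assms)
  finally show ?thesis
    by simp
qed

lemma permutation_mat_entry_in_unit_interval:
  assumes "P \<in> permutation_mats d" "t < d" "q < d"
  shows "P $$ (t, q) \<in> {0..1}"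
  using assms by (auto simp: permutation_mats_def)

text \<open>Row sums and column sums are both needed later: transposing a map that runs downwards makes its
  columns the rows of the oriented input.\<close>

lemma permutation_mat_row:
  assumes "P \<in> permutation_mats d" "t < d"
  shows "(\<Sum>q<d. P $$ (t, q)) = 1"
proof -
  obtain s where s: "P = mat d d (\<lambda>(t, q). if q = s t then 1 else 0)" "s permutes {..<d}"
    using assms by (auto simp: permutation_mats_def)
  have "s t < d"
    using s(2) assms(2) permutes_in_image[of s "{..<d}" t] by auto
  then show ?thesis
    using assms(2) by (simp add: s(1))
qed

lemma permutation_mat_column:
  assumes "P \<in> permutation_mats d" "q < d"
  shows "(\<Sum>t<d. P $$ (t, q)) = 1"
proof -
  obtain s where s: "P = mat d d (\<lambda>(t, q). if q = s t then 1 else 0)" "s permutes {..<d}"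
    using assms by (auto simp: permutation_mats_def)
  have "(\<Sum>t<d. P $$ (t, q)) = (\<Sum>t<d. if q = s t then 1 else 0)"
    using assms(2) by (simp add: s(1))
  also have "\<dots> = (\<Sum>t<d. if q = t then 1 else 0)"
    using sum.permute[OF s(2), of "\<lambda>t. if q = t then 1 else (0::real)"] by (simp add: o_def)
  finally show ?thesis
    using assms(2) by simp
qed

lemma oriented_permutation_row:
  assumes "\<And>e. e \<in> object_pairs n \<Longrightarrow> Xin e \<in> permutation_mats d"
    and "i \<in> {1..n}" "j \<in> {1..n}" "i \<noteq> j" "t < d"
  shows "(\<Sum>q<d. oriented Xin i j t q) = 1"
proof (cases "i < j")
  case True
  then have "Xin (i, j) \<in> permutation_mats d"
    using assms by (auto simp: object_pairs_def)
  then show ?thesis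
    using True permutation_mat_row assms(5) by (simp add: oriented_def)
next
  case False
  then have "Xin (j, i) \<in> permutation_mats d"
    using assms by (auto simp: object_pairs_def)
  then show ?thesis
    using False permutation_mat_column assms(5) by (simp add: oriented_def)
qed

lemma feasible_oriented:
  assumes X: "lp_feasible n d X"
    and V: "i \<in> {1..n}" "j \<in> {1..n}" "i \<noteq> j"
  shows "t < d \<Longrightarrow> q < d \<Longrightarrow> 0 \<le> oriented X i j t q"
    and "t < d \<Longrightarrow> (\<Sum>q<d. oriented X i j t q) = 1"
proof -
  have "(i, j) \<in> object_pairs n" if "i < j"
    using that V by (auto simp: object_pairs_def)
  moreover have "(j, i) \<in> object_pairs n" if "\<not> i < j"
    using that V by (auto simp: object_pairs_def)
  ultimately show "t < d \<Longrightarrow> q < d \<Longrightarrow> 0 \<le> oriented X i j t q"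
    and "t < d \<Longrightarrow> (\<Sum>q<d. oriented X i j t q) = 1"
    using X by (cases "i < j"; simp add: lp_feasible_def oriented_def)+
qed

text \<open>For each of the six orders of \<open>i\<close>, \<open>j\<close>, \<open>k\<close> the inequality is one of the three constraints of
  the linear program, read off after transposing the maps that run downwards.\<close>

lemma feasible_oriented_cycle:
  assumes X: "lp_feasible n d X"
    and V: "i \<in> {1..n}" "j \<in> {1..n}" "k \<in> {1..n}" "distinct [i, j, k]"
    and lt: "l < d" "t < d" "q < d"
  shows "oriented X i j l t + oriented X j k t q - oriented X i k l q \<le> 1"
proof -
  have *: "X (a, b) $$ (l, t) + X (b, c) $$ (t, q) - X (a, c) $$ (l, q) \<le> 1"
    "X (a, b) $$ (l, t) - X (b, c) $$ (t, q) + X (a, c) $$ (l, q) \<le> 1"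
    "- X (a, b) $$ (l, t) + X (b, c) $$ (t, q) + X (a, c) $$ (l, q) \<le> 1"
    if "1 \<le> a" "a < b" "b < c" "c \<le> n" "l < d" "t < d" "q < d" for a b c l t q
    using X that unfolding lp_feasible_def by blast+
  consider "i < j" "j < k" | "i < k" "k < j" | "j < i" "i < k" | "j < k" "k < i"
    | "k < i" "i < j" | "k < j" "j < i"
    using V(4) by fastforce
  then show ?thesis
  proof cases
    case 1 then show ?thesis using V lt *(1)[of i j k l t q] by (simp add: oriented_def)
  next
    case 2 then show ?thesis using V lt *(3)[of i k j l q t] by (simp add: oriented_def)
  next
    case 3 then show ?thesis using V lt *(2)[of j i k t l q] by (simp add: oriented_def)
  next
    case 4 then show ?thesis using V lt *(2)[of j k i t q l] by (simp add: oriented_def)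
  next
    case 5 then show ?thesis using V lt *(3)[of k i j q l t] by (simp add: oriented_def)
  next
    case 6 then show ?thesis using V lt *(1)[of k j i q t l] by (simp add: oriented_def)
  qed
qed

lemma map_pair_oriented:
  assumes "\<And>e. e \<in> object_pairs n \<Longrightarrow> Xin e \<in> permutation_mats d"
    and "lp_feasible n d X"
  shows "map_pair {1..n} d (oriented Xin) (oriented X)"
proof (unfold_locales, goal_cases)
  case (2 i j t q)
  then show ?case
    using permutation_mat_entry_in_unit_interval[OF assms(1)]
    by (auto simp: oriented_def object_pairs_def)
next
  case 3
  show ?case by (rule oriented_sym[OF 3(3)])
next
  case 4
  show ?case using assms(1) 4 by (rule oriented_permutation_row)
next
  case 5
  then show ?case by (rule feasible_oriented(1)[OF assms(2)])
next
  case 6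
  then show ?case by (rule feasible_oriented(2)[OF assms(2)])
next
  case 7
  then show ?case by (rule feasible_oriented_cycle[OF assms(2)])
qed simp

lemma ground_truth_feasible: "lp_feasible n d (ground_truth d)"
  unfolding lp_feasible_def ground_truth_def by (auto simp: one_mat_def)

text \<open>Since all entries of a feasible point add up to \<open>d\<close> on every pair, only the inner product with the
  input distinguishes objective values. Each unordered pair occurs twice among the ordered ones, which
  cancels the factor 2 in the cost \<open>1 - 2 * Xin\<close>.\<close>

lemma objective_gap:
  assumes Xin: "\<And>e. e \<in> object_pairs n \<Longrightarrow> Xin e \<in> permutation_mats d"
    and X: "lp_feasible n d X"
  shows "lp_objective n d Xin X - lp_objective n d Xin (ground_truth d)
       = map_pair.agreeing_defect {1..n} d (oriented Xin) (oriented X)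
         - map_pair.corrupted_mass {1..n} d (oriented Xin) (oriented X)"
proof -
  interpret map_pair "{1..n}" d "oriented Xin" "oriented X"
    using assms by (rule map_pair_oriented)
  let ?h = "\<lambda>i j. (\<Sum>t<d. oriented Xin i j t t * defect i j t)
    - (\<Sum>t<d. \<Sum>q\<in>{..<d} - {t}. oriented Xin i j t q * oriented X i j t q)"
  have "agreeing_defect - corrupted_mass = (\<Sum>i\<in>{1..n}. \<Sum>j\<in>{1..n} - {i}. ?h i j)"
    unfolding agreeing_defect_def corrupted_mass_def sum_subtractf ..
  also have "\<dots> = 2 * (\<Sum>(i, j)\<in>object_pairs n. ?h i j)"
  proof (rule sum_distinct_pairs_eq_object_pairs)
    fix i j :: nat assume ij: "i \<noteq> j"
    have "(\<Sum>t<d. \<Sum>q\<in>{..<d} - {t}. oriented Xin i j t q * oriented X i j t q)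
        = (\<Sum>t<d. \<Sum>q\<in>{..<d} - {t}. oriented Xin i j q t * oriented X i j q t)"
      by (rule sum_distinct_pairs_swap) simp
    then show "?h i j = ?h j i"
      using ij by (simp add: defect_def oriented_sym[of i j])
  qed
  also have "\<dots> = (\<Sum>e\<in>object_pairs n.
      (\<Sum>t<d. \<Sum>q<d. (1 - 2 * Xin e $$ (t, q)) * X e $$ (t, q))
        - (\<Sum>t<d. \<Sum>q<d. (1 - 2 * Xin e $$ (t, q)) * ground_truth d e $$ (t, q)))"
    unfolding sum_distrib_left
  proof (rule sum.cong[OF refl], clarify)
    fix i j assume e: "(i, j) \<in> object_pairs n"
    then have V: "i \<in> {1..n}" "j \<in> {1..n}" "i \<noteq> j" "i < j"
      by (auto simp: object_pairs_def)
    have "(\<Sum>t<d. \<Sum>q<d. (1 - 2 * Xin (i, j) $$ (t, q)) * X (i, j) $$ (t, q)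
            - (1 - 2 * Xin (i, j) $$ (t, q)) * ground_truth d (i, j) $$ (t, q))
        = (\<Sum>t<d. 2 * (oriented Xin i j t t * defect i j t)
            - 2 * (\<Sum>q\<in>{..<d} - {t}. oriented Xin i j t q * oriented X i j t q))"
    proof (rule sum.cong[OF refl])
      fix t assume t: "t \<in> {..<d}"
      have "(\<Sum>q<d. (1 - 2 * Xin (i, j) $$ (t, q)) * X (i, j) $$ (t, q)
            - (1 - 2 * Xin (i, j) $$ (t, q)) * ground_truth d (i, j) $$ (t, q))
          = (\<Sum>q<d. oriented X i j t q) - (\<Sum>q<d. if t = q then 1 else 0)
            - 2 * (\<Sum>q<d. oriented Xin i j t q * (oriented X i j t q - (if t = q then 1 else 0)))"
        unfolding sum_distrib_left sum_subtractf[symmetric]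
        using V t by (intro sum.cong) (auto simp: oriented_def ground_truth_def algebra_simps)
      also have "\<dots> = - 2 * (\<Sum>q<d. oriented Xin i j t q * (oriented X i j t q - (if t = q then 1 else 0)))"
        using t Y_row[OF V(1-3), of t] by simp
      also have "\<dots> = 2 * (oriented Xin i j t t * defect i j t)
            - 2 * (\<Sum>q\<in>{..<d} - {t}. oriented Xin i j t q * oriented X i j t q)"
        using t by (subst sum.remove[of _ t]) (auto simp: defect_def algebra_simps)
      finally show "(\<Sum>q<d. (1 - 2 * Xin (i, j) $$ (t, q)) * X (i, j) $$ (t, q)
            - (1 - 2 * Xin (i, j) $$ (t, q)) * ground_truth d (i, j) $$ (t, q)) = \<dots>" .
    qed
    then show "2 * ?h i j
        = (\<Sum>t<d. \<Sum>q<d. (1 - 2 * Xin (i, j) $$ (t, q)) * X (i, j) $$ (t, q))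
          - (\<Sum>t<d. \<Sum>q<d. (1 - 2 * Xin (i, j) $$ (t, q)) * ground_truth d (i, j) $$ (t, q))"
      by (simp add: sum_subtractf sum_distrib_left)
  qed
  also have "\<dots> = lp_objective n d Xin X - lp_objective n d Xin (ground_truth d)"
    by (simp add: lp_objective_def sum_subtractf)
  finally show ?thesis ..
qed

text \<open>The only property of the random input that recovery depends on. For an element \<open>q\<close> the
  first count runs over the maps out of \<open>j\<close> that fix \<open>q\<close>, the second over the two-step paths from \<open>i\<close> to \<open>j\<close> that send
  \<open>t\<close> to \<open>q\<close> and then fix \<open>q\<close>; both are compared with their expectations over \<open>n - 2\<close> choices of \<open>k\<close>.\<close>

definition balanced :: "nat \<Rightarrow> nat \<Rightarrow> real \<Rightarrow> real \<Rightarrow> real \<Rightarrow> (nat \<times> nat \<Rightarrow> real mat) \<Rightarrow> bool" where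
  "balanced n d g r \<epsilon> Xin \<longleftrightarrow> (\<forall>i\<in>{1..n}. \<forall>j\<in>{1..n} - {i}. \<forall>t<d. \<forall>q<d.
     \<bar>(\<Sum>k\<in>{1..n} - {i, j}. oriented Xin j k q q) - (real n - 2) * g\<bar> < \<epsilon> * (real n - 2) \<and>
     \<bar>(\<Sum>k\<in>{1..n} - {i, j}. oriented Xin i k t q * oriented Xin k j q q)
       - (real n - 2) * ((if t = q then g else r) * g)\<bar> < \<epsilon> * (real n - 2))"

text \<open>By \<open>objective_gap\<close> and \<open>agreement_dominates_corruption\<close> no feasible point beats the ground truth, and
  one that ties has no defect at all. Its diagonals are then all 1, and the row sums force the
  remaining entries to vanish.\<close>

lemma balanced_recovers:
  assumes Xin: "\<And>e. e \<in> object_pairs n \<Longrightarrow> Xin e \<in> permutation_mats d"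
    and n: "n \<ge> 3" and p: "1 / 2 < p" and r: "0 \<le> r" "p + r \<le> 1"
    and bal: "balanced n d (p + r) r ((2 * p - 1) / 20) Xin"
  shows "lp_recovers_ground_truth n d Xin"
proof -
  have gap: "lp_objective n d Xin (ground_truth d) \<le> lp_objective n d Xin X \<and>
    (lp_objective n d Xin X \<le> lp_objective n d Xin (ground_truth d)
      \<longrightarrow> (\<forall>e\<in>object_pairs n. X e = ground_truth d e))"
    if X: "lp_feasible n d X" for X
  proof -
    interpret map_pair "{1..n}" d "oriented Xin" "oriented X"
      using Xin X by (rule map_pair_oriented)
    have N: "real (card {1..n}) - 2 = real n - 2" "0 < real (card {1..n}) - 2"
      using n by auto
    have degree: "\<bar>(\<Sum>k\<in>{1..n} - {i, j}. oriented Xin j k q q) - (real (card {1..n}) - 2) * (p + r)\<bar>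
        \<le> (2 * p - 1) / 20 * (real (card {1..n}) - 2)"
      if "i \<in> {1..n}" "j \<in> {1..n}" "i \<noteq> j" "q < d" for i j q
      using bal that unfolding balanced_def N(1) by (blast intro: less_imp_le)
    have paths: "\<bar>(\<Sum>k\<in>{1..n} - {i, j}. oriented Xin i k t q * oriented Xin k j q q)
          - (real (card {1..n}) - 2) * ((if t = q then p + r else r) * (p + r))\<bar>
        \<le> (2 * p - 1) / 20 * (real (card {1..n}) - 2)"
      if "i \<in> {1..n}" "j \<in> {1..n}" "i \<noteq> j" "t < d" "q < d" for i j t q
      using bal that unfolding balanced_def N(1) by (blast intro: less_imp_le)
    note dominates = agreement_dominates_corruption[OF p r refl N(2) degree paths]
    have le: "corrupted_mass \<le> agreeing_defect"
      by (rule dominates(1))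
    have zero: "agreeing_defect \<le> corrupted_mass \<Longrightarrow> total_defect \<le> 0"
      by (rule dominates(2))
    have "X e = ground_truth d e"
      if tot: "total_defect \<le> 0" and e: "e \<in> object_pairs n" for e
    proof -
      obtain i j where ij: "e = (i, j)" "i \<in> {1..n}" "j \<in> {1..n}" "i \<noteq> j" "i < j"
        using e by (auto simp: object_pairs_def)
      have diag: "X e $$ (t, t) = 1" if "t < d" for t
        using total_defect_zeroD[OF tot ij(2-4) that] ij by (simp add: defect_def oriented_def)
      have off: "X e $$ (t, q) = 0" if "t < d" "q < d" "t \<noteq> q" for t q
      proof -
        have "(\<Sum>q\<in>{..<d} - {t}. oriented X i j t q) = 0"
          using total_defect_zeroD[OF tot ij(2-4) that(1)]
            defect_eq_offdiagonal[OF ij(2-4) that(1)] by simp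
        moreover have "\<And>q. q \<in> {..<d} - {t} \<Longrightarrow> 0 \<le> oriented X i j t q"
          using Y_nonneg ij that by auto
        ultimately have "oriented X i j t q = 0"
          using that sum_nonneg_eq_0_iff[of "{..<d} - {t}" "oriented X i j t"] by auto
        then show ?thesis
          using ij by (simp add: oriented_def)
      qed
      have "X e \<in> carrier_mat d d"
        using X e by (auto simp: lp_feasible_def)
      then show ?thesis
        using diag off by (intro eq_matI) (auto simp: ground_truth_def)
    qed
    moreover have "lp_objective n d Xin X - lp_objective n d Xin (ground_truth d)
        = agreeing_defect - corrupted_mass"
      using Xin X by (rule objective_gap)
    ultimately show ?thesis
      using le zero by auto
  qed
  then show ?thesis
    using ground_truth_feasible unfolding lp_recovers_ground_truth_def lp_optimal_def by blast
qed

section \<open>Concentration for products of independent coordinates\<close>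

text \<open>Both factors are extended by the constant 1 to a product over all coordinates, which
  \<open>expectation_prod_Pi_pmf\<close> factorises.\<close>

lemma expectation_two_coordinates_Pi_pmf:
  fixes f h :: "'b \<Rightarrow> real"
  assumes E: "finite E" "a \<in> E" "b \<in> E" "a \<noteq> b" and fin: "finite (set_pmf \<nu>)"
    and f: "\<And>x. x \<in> set_pmf \<nu> \<Longrightarrow> 0 \<le> f x" and h: "\<And>x. x \<in> set_pmf \<nu> \<Longrightarrow> 0 \<le> h x"
  shows "measure_pmf.expectation (Pi_pmf E dflt (\<lambda>_. \<nu>)) (\<lambda>\<omega>. f (\<omega> a) * h (\<omega> b))
    = measure_pmf.expectation \<nu> f * measure_pmf.expectation \<nu> h"
proof -
  let ?g = "\<lambda>e. if e = a then f else if e = b then h else (\<lambda>_. 1)"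
  have two: "(\<Prod>e\<in>E. w e) = w a * w b" if "\<And>e. e \<in> E - {a, b} \<Longrightarrow> w e = 1" for w :: "_ \<Rightarrow> real"
    using prod.mono_neutral_right[of E "{a, b}" w] E that by simp
  have "measure_pmf.expectation (Pi_pmf E dflt (\<lambda>_. \<nu>)) (\<lambda>\<omega>. f (\<omega> a) * h (\<omega> b))
      = measure_pmf.expectation (Pi_pmf E dflt (\<lambda>_. \<nu>)) (\<lambda>\<omega>. \<Prod>e\<in>E. ?g e (\<omega> e))"
    by (subst two) (use E in auto)
  also have "\<dots> = (\<Prod>e\<in>E. measure_pmf.expectation \<nu> (?g e))"
    by (rule expectation_prod_Pi_pmf) (use E f h fin in \<open>auto intro: integrable_measure_pmf_finite\<close>)
  also have "\<dots> = measure_pmf.expectation \<nu> f * measure_pmf.expectation \<nu> h"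
    by (subst two) (use E in auto)
  finally show ?thesis .
qed

text \<open>The summands use disjoint sets of coordinates, hence are independent, and Hoeffding's inequality
  applies. Summands with two coordinates are needed because a path \<open>i, k, j\<close> involves two input maps;
  different \<open>k\<close> use different maps.\<close>

lemma Pi_pmf_two_coordinate_sum_concentration:
  fixes f h :: "'j \<Rightarrow> 'b \<Rightarrow> real" and a b :: "'j \<Rightarrow> 'e"
  assumes E: "finite E" and J: "finite J" "J \<noteq> {}" and fin: "finite (set_pmf \<nu>)"
    and ab: "\<And>j. j \<in> J \<Longrightarrow> a j \<in> E" "\<And>j. j \<in> J \<Longrightarrow> b j \<in> E" "\<And>j. j \<in> J \<Longrightarrow> a j \<noteq> b j"
    and disj: "disjoint_family_on (\<lambda>j. {a j, b j}) J"
    and f: "\<And>j x. j \<in> J \<Longrightarrow> x \<in> set_pmf \<nu> \<Longrightarrow> f j x \<in> {0..1}"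
    and h: "\<And>j x. j \<in> J \<Longrightarrow> x \<in> set_pmf \<nu> \<Longrightarrow> h j x \<in> {0..1}"
    and Ef: "\<And>j. j \<in> J \<Longrightarrow> measure_pmf.expectation \<nu> (f j) = \<alpha>"
    and Eh: "\<And>j. j \<in> J \<Longrightarrow> measure_pmf.expectation \<nu> (h j) = \<beta>"
    and eps: "\<epsilon> \<ge> 0"
  shows "measure_pmf.prob (Pi_pmf E dflt (\<lambda>_. \<nu>))
      {\<omega>. \<bar>(\<Sum>j\<in>J. f j (\<omega> (a j)) * h j (\<omega> (b j))) - real (card J) * (\<alpha> * \<beta>)\<bar> \<ge> \<epsilon> * real (card J)}
    \<le> 2 * exp (-2 * \<epsilon>\<^sup>2 * real (card J))"
proof -
  define P where "P = Pi_pmf E dflt (\<lambda>_. \<nu>)"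
  define X where "X = (\<lambda>j \<omega>. f j (\<omega> (a j)) * h j (\<omega> (b j)))"
  have coord: "\<omega> e \<in> set_pmf \<nu>" if "\<omega> \<in> set_pmf P" "e \<in> E" for \<omega> e
    using that E by (auto simp: P_def set_Pi_pmf PiE_dflt_def)
  have "prob_space.indep_vars (measure_pmf P) (\<lambda>_. count_space UNIV) (\<lambda>e \<omega>. \<omega> e) E"
    unfolding P_def by (rule indep_vars_Pi_pmf[OF E])
  then have "prob_space.indep_vars (measure_pmf P) (\<lambda>j. PiM {a j, b j} (\<lambda>_. count_space UNIV))
      (\<lambda>j \<omega>. restrict (\<lambda>e. \<omega> e) {a j, b j}) J"
  proof (rule prob_space.indep_vars_restrict[OF measure_pmf.prob_space_axioms])
    show "{a j, b j} \<subseteq> E" if "j \<in> J" for j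
      using ab[OF that] by blast
  qed (rule disj)
  then have "prob_space.indep_vars (measure_pmf P) (\<lambda>_. borel)
      (\<lambda>j \<omega>. f j (restrict (\<lambda>e. \<omega> e) {a j, b j} (a j)) * h j (restrict (\<lambda>e. \<omega> e) {a j, b j} (b j))) J"
  proof (rule prob_space.indep_vars_compose2[OF measure_pmf.prob_space_axioms])
    fix j assume "j \<in> J"
    have "(\<lambda>x. f j (x (a j))) \<in> borel_measurable (PiM {a j, b j} (\<lambda>_. count_space UNIV))"
      by (rule measurable_compose[OF measurable_component_singleton]) auto
    moreover have "(\<lambda>x. h j (x (b j))) \<in> borel_measurable (PiM {a j, b j} (\<lambda>_. count_space UNIV))"
      by (rule measurable_compose[OF measurable_component_singleton]) auto
    ultimately show "(\<lambda>x. f j (x (a j)) * h j (x (b j)))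
        \<in> borel_measurable (PiM {a j, b j} (\<lambda>_. count_space UNIV))"
      by (rule borel_measurable_times)
  qed
  then have indep: "prob_space.indep_vars (measure_pmf P) (\<lambda>_. borel) X J"
    by (simp add: X_def)
  interpret H: Hoeffding_ineq "measure_pmf P" J X "\<lambda>_. 0" "\<lambda>_. 1" "\<Sum>j\<in>J. measure_pmf.expectation P (X j)"
  proof (unfold_locales, rule J(1), rule indep)
    fix j assume j: "j \<in> J"
    show "AE \<omega> in measure_pmf P. X j \<omega> \<in> {0..1}"
    proof (rule AE_pmfI)
      fix \<omega> assume "\<omega> \<in> set_pmf P"
      then show "X j \<omega> \<in> {0..1}"
        using f[OF j coord[of \<omega> "a j"]] h[OF j coord[of \<omega> "b j"]] ab[OF j]
        by (auto simp: X_def intro!: mult_le_one)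
    qed
  qed simp
  have "measure_pmf.expectation P (X j) = \<alpha> * \<beta>" if "j \<in> J" for j
    unfolding X_def P_def
    using expectation_two_coordinates_Pi_pmf[of E "a j" "b j" \<nu> "f j" "h j" dflt]
      E ab[OF that] fin f[OF that] h[OF that] Ef[OF that] Eh[OF that] by simp
  then have mu: "(\<Sum>j\<in>J. measure_pmf.expectation P (X j)) = real (card J) * (\<alpha> * \<beta>)"
    by simp
  have "0 < card J"
    using J by (simp add: card_gt_0_iff)
  then have "measure_pmf.prob P {\<omega>. \<bar>(\<Sum>j\<in>J. X j \<omega>) - real (card J) * (\<alpha> * \<beta>)\<bar> \<ge> \<epsilon> * real (card J)}
      \<le> 2 * exp (-2 * (\<epsilon> * real (card J))\<^sup>2 / real (card J))"
    using H.Hoeffding_ineq_abs_ge[of "\<epsilon> * real (card J)"] eps mu by simp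
  also have "-2 * (\<epsilon> * real (card J))\<^sup>2 / real (card J) = -2 * \<epsilon>\<^sup>2 * real (card J)"
    using \<open>0 < card J\<close> by (simp add: power2_eq_square)
  finally show ?thesis
    by (simp add: P_def X_def)
qed

section \<open>The law of a single input map\<close>

definition corrupted_map :: "nat \<Rightarrow> bool \<times> real mat \<Rightarrow> real mat" where
  "corrupted_map d = (\<lambda>(z, P). of_bool z \<cdot>\<^sub>m 1\<^sub>m d + (1 - of_bool z) \<cdot>\<^sub>m P)"

definition edge_law :: "nat \<Rightarrow> real \<Rightarrow> real mat pmf" where
  "edge_law d p =
     map_pmf (corrupted_map d) (pair_pmf (bernoulli_pmf p) (pmf_of_set (permutation_mats d)))"

text \<open>Corruption acts on each pair separately, so the input maps are again independent, with a common law.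
  The default value outside the pairs is the image of the default before corruption.\<close>

lemma random_corruption_eq_Pi_pmf:
  "random_corruption n d p =
     Pi_pmf (object_pairs n) (corrupted_map d undefined) (\<lambda>_. edge_law d p)"
  unfolding random_corruption_def edge_law_def corrupted_map_def
  by (subst Pi_pmf_map[where dflt = undefined]) (simp_all add: finite_object_pairs o_def[abs_def])

lemma set_pmf_edge_law: "set_pmf (edge_law d p) \<subseteq> permutation_mats d"
proof -
  have "1\<^sub>m d = mat d d (\<lambda>(t, q). if q = id t then 1 else (0::real))"
    by (rule eq_matI) auto
  then have one: "1\<^sub>m d \<in> permutation_mats d"
    unfolding permutation_mats_def using permutes_id by blast
  have "of_bool z \<cdot>\<^sub>m 1\<^sub>m d + (1 - of_bool z) \<cdot>\<^sub>m P = (if z then 1\<^sub>m d else P)"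
    if "P \<in> permutation_mats d" for z and P :: "real mat"
    using that by (intro eq_matI) (auto simp: permutation_mats_def)
  then show ?thesis
    using one by (auto simp: edge_law_def corrupted_map_def permutation_mats_finite permutation_mats_nonempty)
qed

text \<open>Swapping two columns is an involution of the set of permutation matrices. It shows that the
  entries of one row of a uniformly random permutation matrix have equal expectations.\<close>

lemma swap_columns_permutation_mats:
  assumes P: "P \<in> permutation_mats d" and "a < d" "b < d"
  defines "Q \<equiv> mat d d (\<lambda>(t, q). P $$ (t, Transposition.transpose a b q))"
  shows "Q \<in> permutation_mats d"
    and "mat d d (\<lambda>(t, q). Q $$ (t, Transposition.transpose a b q)) = P"
proof -
  let ?\<tau> = "Transposition.transpose a b"
  obtain s where s: "P = mat d d (\<lambda>(t, q). if q = s t then 1 else 0)" "s permutes {..<d}"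
    using P by (auto simp: permutation_mats_def)
  have tau: "?\<tau> permutes {..<d}"
    using assms by (intro permutes_swap_id) auto
  have lt: "?\<tau> q < d" if "q < d" for q
    using permutes_in_image[OF tau] that by auto
  have moved: "?\<tau> q = x \<longleftrightarrow> q = ?\<tau> x" for q x
    by (metis transpose_involutory)
  have "Q = mat d d (\<lambda>(t, q). if q = (?\<tau> \<circ> s) t then 1 else 0)"
    using lt by (intro eq_matI) (auto simp: Q_def s(1) moved)
  then show "Q \<in> permutation_mats d"
    using permutes_compose[OF s(2) tau] unfolding permutation_mats_def by blast
  show "mat d d (\<lambda>(t, q). Q $$ (t, ?\<tau> q)) = P"
    using lt by (intro eq_matI) (auto simp: Q_def s(1))
qed

text \<open>The \<open>d\<close> entries of a row have the same expectation by symmetry and add up to 1.\<close>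

lemma expectation_uniform_permutation_entry:
  assumes "t < d" "q < d"
  shows "measure_pmf.expectation (pmf_of_set (permutation_mats d)) (\<lambda>P. P $$ (t, q)) = 1 / real d"
proof -
  let ?S = "permutation_mats d"
  have eq: "(\<Sum>P\<in>?S. P $$ (t, c)) = (\<Sum>P\<in>?S. P $$ (t, q))" if "c < d" for c
    by (rule sum.reindex_bij_witness[where
          i = "\<lambda>P. mat d d (\<lambda>(t, x). P $$ (t, Transposition.transpose c q x))" and
          j = "\<lambda>P. mat d d (\<lambda>(t, x). P $$ (t, Transposition.transpose c q x))"])
       (use that assms swap_columns_permutation_mats[of _ d c q] in auto)
  have "real d * (\<Sum>P\<in>?S. P $$ (t, q)) = (\<Sum>c<d. \<Sum>P\<in>?S. P $$ (t, c))"
    using eq by simp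
  also have "\<dots> = (\<Sum>P\<in>?S. \<Sum>c<d. P $$ (t, c))"
    by (rule sum.swap)
  also have "\<dots> = real (card ?S)"
    using permutation_mat_row assms(1) by simp
  finally have "real d * (\<Sum>P\<in>?S. P $$ (t, q)) = real (card ?S)" .
  moreover have "0 < card ?S"
    by (simp add: card_gt_0_iff permutation_mats_finite permutation_mats_nonempty)
  ultimately show ?thesis
    using assms
    by (simp add: integral_pmf_of_set permutation_mats_finite permutation_mats_nonempty field_simps)
qed

text \<open>These are the values \<open>g\<close> (diagonal) and \<open>r\<close> (off the diagonal) of the counting argument: a corrupted
  map still fixes a given element with probability \<open>1 / d\<close>.\<close>

lemma expectation_edge_law_entry:
  assumes p: "0 \<le> p" "p \<le> 1" and lt: "t < d" "q < d"
  shows "measure_pmf.expectation (edge_law d p) (\<lambda>P. P $$ (t, q))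
    = (if t = q then p + (1 - p) / real d else (1 - p) / real d)"
proof -
  let ?S = "permutation_mats d"
  let ?U = "pmf_of_set ?S"
  have dims: "dim_row P = d" "dim_col P = d" if "P \<in> ?S" for P
    using that by (auto simp: permutation_mats_def)
  have "measure_pmf.expectation (edge_law d p) (\<lambda>P. P $$ (t, q))
      = measure_pmf.expectation (pair_pmf (bernoulli_pmf p) ?U)
          (\<lambda>(z, P). (of_bool z \<cdot>\<^sub>m 1\<^sub>m d + (1 - of_bool z) \<cdot>\<^sub>m P) $$ (t, q))"
    by (simp add: edge_law_def corrupted_map_def case_prod_unfold)
  also have "\<dots> = (\<Sum>zP\<in>UNIV \<times> ?S. pmf (pair_pmf (bernoulli_pmf p) ?U) zP *\<^sub>R
      (case zP of (z, P) \<Rightarrow> (of_bool z \<cdot>\<^sub>m 1\<^sub>m d + (1 - of_bool z) \<cdot>\<^sub>m P) $$ (t, q)))"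
    by (rule integral_measure_pmf) (auto simp: permutation_mats_finite permutation_mats_nonempty)
  also have "\<dots> = (\<Sum>z\<in>UNIV. \<Sum>P\<in>?S. pmf (bernoulli_pmf p) z * pmf ?U P *
      (of_bool z * of_bool (t = q) + (1 - of_bool z) * P $$ (t, q)))"
    unfolding sum.cartesian_product
    using lt by (intro sum.cong) (auto simp: pmf_pair dims)
  also have "\<dots> = p * of_bool (t = q) * (\<Sum>P\<in>?S. pmf ?U P) + (1 - p) * (\<Sum>P\<in>?S. pmf ?U P * P $$ (t, q))"
    using p by (simp add: UNIV_bool sum_distrib_left mult_ac)
  also have "(\<Sum>P\<in>?S. pmf ?U P) = 1"
    by (rule sum_pmf_eq_1) (auto simp: permutation_mats_finite permutation_mats_nonempty)
  also have "(\<Sum>P\<in>?S. pmf ?U P * P $$ (t, q)) = measure_pmf.expectation ?U (\<lambda>P. P $$ (t, q))"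
    by (subst integral_measure_pmf[of ?S]) (auto simp: permutation_mats_finite permutation_mats_nonempty)
  also have "\<dots> = 1 / real d"
    by (rule expectation_uniform_permutation_entry[OF lt])
  finally show ?thesis
    by simp
qed

section \<open>Recovery with high probability\<close>

text \<open>\<open>edge\<close> names the coordinate of the product space on which the map between \<open>i\<close> and \<open>j\<close> depends, and
  \<open>entry\<close> reads the oriented value off that coordinate, so that \<open>oriented\<close> becomes a function of a
  single independent coordinate.\<close>

definition edge :: "nat \<Rightarrow> nat \<Rightarrow> nat \<times> nat" where
  "edge i j = (min i j, max i j)"

lemma edge_eq_iff: "edge i j = edge k l \<longleftrightarrow> i = k \<and> j = l \<or> i = l \<and> j = k"
  by (auto simp: edge_def min_def max_def)

lemma edge_in_object_pairs: "edge i j \<in> object_pairs n \<longleftrightarrow> i \<in> {1..n} \<and> j \<in> {1..n} \<and> i \<noteq> j"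
  by (auto simp: edge_def object_pairs_def min_def max_def)

definition entry :: "nat \<Rightarrow> nat \<Rightarrow> nat \<Rightarrow> nat \<Rightarrow> real mat \<Rightarrow> real" where
  "entry i j t q P = (if i < j then P $$ (t, q) else P $$ (q, t))"

lemma oriented_eq_entry: "i \<noteq> j \<Longrightarrow> oriented X i j t q = entry i j t q (X (edge i j))"
  by (auto simp: oriented_def entry_def edge_def min_def max_def)

text \<open>Since \<open>k\<close> is neither \<open>i\<close> nor \<open>j\<close>, the pairs \<open>{i, k}\<close> and \<open>{k, j}\<close> are all different as \<open>k\<close>
  varies, so each count is a sum of independent terms. A two-step count has as mean term the product of the
  means for its two different pairs.\<close>

lemma random_counts_concentrate:
  fixes n d :: nat and p \<epsilon> :: real
  assumes p: "0 \<le> p" "p \<le> 1" and n: "n \<ge> 3" and eps: "\<epsilon> \<ge> 0"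
    and ij: "i \<in> {1..n}" "j \<in> {1..n}" "i \<noteq> j" and lt: "t < d" "q < d"
  defines "r \<equiv> (1 - p) / real d"
  shows "measure_pmf.prob (random_corruption n d p)
      {Xin. \<bar>(\<Sum>k\<in>{1..n} - {i, j}. oriented Xin j k q q) - (real n - 2) * (p + r)\<bar> \<ge> \<epsilon> * (real n - 2)}
      \<le> 2 * exp (-2 * \<epsilon>\<^sup>2 * (real n - 2))" (is "?A \<le> ?bound")
    and "measure_pmf.prob (random_corruption n d p)
      {Xin. \<bar>(\<Sum>k\<in>{1..n} - {i, j}. oriented Xin i k t q * oriented Xin k j q q)
          - (real n - 2) * ((if t = q then p + r else r) * (p + r))\<bar> \<ge> \<epsilon> * (real n - 2)}
      \<le> 2 * exp (-2 * \<epsilon>\<^sup>2 * (real n - 2))" (is "?B \<le> _")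
proof -
  note law = random_corruption_eq_Pi_pmf[of n d p]
  let ?J = "{1..n} - {i, j}"
  have card_J: "real (card ?J) = real n - 2"
  proof -
    have "card ?J = card {1..n} - card {i, j}"
      using ij by (intro card_Diff_subset) auto
    then show ?thesis
      using ij n by simp
  qed
  then have "0 < card ?J"
    using n by linarith
  then have J: "finite ?J" "?J \<noteq> {}"
    by (simp, metis card.empty less_irrefl)
  have fin: "finite (set_pmf (edge_law d p))"
    using set_pmf_edge_law permutation_mats_finite by (rule finite_subset)
  have edges: "edge i k \<in> object_pairs n" "edge k j \<in> object_pairs n" "edge j k \<in> object_pairs n"
      "edge i k \<noteq> edge k j" "edge j k \<noteq> edge i k" if "k \<in> ?J" for k
    using that ij unfolding edge_in_object_pairs edge_eq_iff by auto
  have disj: "disjoint_family_on (\<lambda>k. {edge i k, edge k j}) ?J"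
    "disjoint_family_on (\<lambda>k. {edge j k, edge i k}) ?J"
    using ij(3) unfolding disjoint_family_on_def by (auto simp: edge_eq_iff)
  have unit: "entry x k a b P \<in> {0..1}" if "P \<in> set_pmf (edge_law d p)" "a < d" "b < d" for x k a b P
    using that set_pmf_edge_law permutation_mat_entry_in_unit_interval
    unfolding entry_def by (metis subsetD)
  have mean: "measure_pmf.expectation (edge_law d p) (entry x k a b) = (if a = b then p + r else r)"
    if "a < d" "b < d" for x k a b
    using that p by (cases "x < k") (auto simp: entry_def[abs_def] expectation_edge_law_entry r_def)
  \<comment> \<open>One-step counts are treated as two-step counts whose other factor is the constant 1.\<close>
  have "?A = measure_pmf.prob (Pi_pmf (object_pairs n) (corrupted_map d undefined) (\<lambda>_. edge_law d p))
      {\<omega>. \<bar>(\<Sum>k\<in>?J. entry j k q q (\<omega> (edge j k)) * 1) - real (card ?J) * ((p + r) * 1)\<bar>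
        \<ge> \<epsilon> * real (card ?J)}"
    using ij unfolding card_J law by (simp add: oriented_eq_entry)
  also have "\<dots> \<le> 2 * exp (-2 * \<epsilon>\<^sup>2 * real (card ?J))"
    by (rule Pi_pmf_two_coordinate_sum_concentration[where b = "edge i" and a = "edge j"
          and f = "\<lambda>k. entry j k q q" and h = "\<lambda>_ _. 1" and \<alpha> = "p + r" and \<beta> = 1,
          OF finite_object_pairs J fin edges(3,1,5) disj(2) unit _ _ _ eps])
       (simp_all add: lt mean)
  finally show "?A \<le> ?bound"
    unfolding card_J .
  have "?B = measure_pmf.prob (Pi_pmf (object_pairs n) (corrupted_map d undefined) (\<lambda>_. edge_law d p))
      {\<omega>. \<bar>(\<Sum>k\<in>?J. entry i k t q (\<omega> (edge i k)) * entry k j q q (\<omega> (edge k j)))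
        - real (card ?J) * ((if t = q then p + r else r) * (p + r))\<bar> \<ge> \<epsilon> * real (card ?J)}"
    using ij unfolding card_J law by (simp add: oriented_eq_entry)
  also have "\<dots> \<le> 2 * exp (-2 * \<epsilon>\<^sup>2 * real (card ?J))"
    by (rule Pi_pmf_two_coordinate_sum_concentration[where a = "edge i" and b = "\<lambda>k. edge k j"
          and f = "\<lambda>k. entry i k t q" and h = "\<lambda>k. entry k j q q",
          OF finite_object_pairs J fin edges(1,2,4) disj(1) unit unit _ _ eps])
       (simp_all add: lt mean)
  finally show "?B \<le> ?bound"
    unfolding card_J .
qed

text \<open>A union bound over the at most \<open>n\<^sup>2 d\<^sup>2\<close> choices of \<open>i\<close>, \<open>j\<close>, \<open>t\<close>, \<open>q\<close>, with two counts each.\<close>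

lemma prob_not_balanced_le:
  fixes n d :: nat and p \<epsilon> :: real
  assumes p: "0 \<le> p" "p \<le> 1" and n: "n \<ge> 3" and eps: "\<epsilon> \<ge> 0"
  defines "r \<equiv> (1 - p) / real d"
  shows "measure_pmf.prob (random_corruption n d p) {Xin. \<not> balanced n d (p + r) r \<epsilon> Xin}
    \<le> (real n)\<^sup>2 * (real d)\<^sup>2 * (4 * exp (-2 * \<epsilon>\<^sup>2 * (real n - 2)))"
proof -
  let ?P = "random_corruption n d p"
  let ?I = "(SIGMA i:{1..n}. {1..n} - {i}) \<times> ({..<d} \<times> {..<d})"
  let ?A = "\<lambda>((i, j), (t, q)). {Xin.
      \<bar>(\<Sum>k\<in>{1..n} - {i, j}. oriented Xin j k q q) - (real n - 2) * (p + r)\<bar> \<ge> \<epsilon> * (real n - 2)}"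
  let ?B = "\<lambda>((i, j), (t, q)). {Xin.
      \<bar>(\<Sum>k\<in>{1..n} - {i, j}. oriented Xin i k t q * oriented Xin k j q q)
          - (real n - 2) * ((if t = q then p + r else r) * (p + r))\<bar> \<ge> \<epsilon> * (real n - 2)}"
  have "{Xin. \<not> balanced n d (p + r) r \<epsilon> Xin} \<subseteq> (\<Union>x\<in>?I. ?A x \<union> ?B x)"
  proof
    fix Xin assume "Xin \<in> {Xin. \<not> balanced n d (p + r) r \<epsilon> Xin}"
    then obtain i j t q where ijtq: "i \<in> {1..n}" "j \<in> {1..n} - {i}" "t < d" "q < d"
      and "Xin \<in> ?A ((i, j), (t, q)) \<union> ?B ((i, j), (t, q))"
      unfolding balanced_def Un_iff split_conv mem_Collect_eq not_less[symmetric] by blast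
    moreover have "((i, j), (t, q)) \<in> ?I"
      using ijtq by auto
    ultimately show "Xin \<in> (\<Union>x\<in>?I. ?A x \<union> ?B x)"
      by (intro UN_I)
  qed
  then have "measure_pmf.prob ?P {Xin. \<not> balanced n d (p + r) r \<epsilon> Xin}
      \<le> measure_pmf.prob ?P (\<Union>x\<in>?I. ?A x \<union> ?B x)"
    by (rule measure_pmf.finite_measure_mono) simp
  also have "\<dots> \<le> (\<Sum>x\<in>?I. measure_pmf.prob ?P (?A x \<union> ?B x))"
    by (rule measure_UNION_le) auto
  also have "\<dots> \<le> (\<Sum>x\<in>?I. 4 * exp (-2 * \<epsilon>\<^sup>2 * (real n - 2)))"
  proof (rule sum_mono)
    fix x assume x: "x \<in> ?I"
    have "measure_pmf.prob ?P (?A x \<union> ?B x) \<le> measure_pmf.prob ?P (?A x) + measure_pmf.prob ?P (?B x)"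
      by (rule measure_Un_le) auto
    also have "\<dots> \<le> 2 * exp (-2 * \<epsilon>\<^sup>2 * (real n - 2)) + 2 * exp (-2 * \<epsilon>\<^sup>2 * (real n - 2))"
    proof (rule add_mono)
      obtain i j t q where eq: "x = ((i, j), (t, q))"
        by (metis surj_pair)
      have "i \<in> {1..n}" "j \<in> {1..n}" "i \<noteq> j" "t < d" "q < d"
        using x unfolding eq by auto
      note counts = random_counts_concentrate[OF p n eps this, folded r_def]
      show "measure_pmf.prob ?P (?A x) \<le> 2 * exp (-2 * \<epsilon>\<^sup>2 * (real n - 2))"
        using counts(1) unfolding eq split_conv .
      show "measure_pmf.prob ?P (?B x) \<le> 2 * exp (-2 * \<epsilon>\<^sup>2 * (real n - 2))"
        using counts(2) unfolding eq split_conv .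
    qed
    finally show "measure_pmf.prob ?P (?A x \<union> ?B x) \<le> 4 * exp (-2 * \<epsilon>\<^sup>2 * (real n - 2))"
      by simp
  qed
  also have "\<dots> = real (card ?I) * (4 * exp (-2 * \<epsilon>\<^sup>2 * (real n - 2)))"
    by simp
  also have "\<dots> \<le> (real n)\<^sup>2 * (real d)\<^sup>2 * (4 * exp (-2 * \<epsilon>\<^sup>2 * (real n - 2)))"
  proof (rule mult_right_mono)
    have "card ?I \<le> card (({1..n} \<times> {1..n}) \<times> ({..<d} \<times> {..<d}))"
      by (intro card_mono) auto
    then have "card ?I \<le> n\<^sup>2 * d\<^sup>2"
      by (simp add: card_cartesian_product power2_eq_square)
    then show "real (card ?I) \<le> (real n)\<^sup>2 * (real d)\<^sup>2"
      by (metis of_nat_le_iff of_nat_mult of_nat_power)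
  qed simp
  finally show ?thesis .
qed

text \<open>All matrices in the support of the input law are permutation matrices, so almost surely recovery can
  only fail if some count is off.\<close>

lemma prob_recovers_ge:
  assumes p: "1 / 2 < p" "p \<le> 1" and n: "n \<ge> 3" and d: "d \<ge> 1"
  shows "measure_pmf.prob (random_corruption n d p) {Xin. lp_recovers_ground_truth n d Xin}
    \<ge> 1 - (real n)\<^sup>2 * (real d)\<^sup>2 * (4 * exp (-2 * ((2 * p - 1) / 20)\<^sup>2 * (real n - 2)))"
proof -
  let ?P = "random_corruption n d p" and ?r = "(1 - p) / real d" and ?\<epsilon> = "(2 * p - 1) / 20"
  let ?bad = "{Xin. \<not> balanced n d (p + ?r) ?r ?\<epsilon> Xin}"
  have "?r \<le> (1 - p) / 1"
    using p d by (intro divide_left_mono) auto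
  then have r: "0 \<le> ?r" "p + ?r \<le> 1"
    using p by auto
  note law = random_corruption_eq_Pi_pmf[of n d p]
  have supp: "Xin e \<in> permutation_mats d" if "Xin \<in> set_pmf ?P" "e \<in> object_pairs n" for Xin e
  proof -
    have "Xin e \<in> set_pmf (edge_law d p)"
      using that by (cases e) (auto simp: law set_Pi_pmf finite_object_pairs PiE_dflt_def)
    then show ?thesis
      using set_pmf_edge_law by blast
  qed
  have "1 - measure_pmf.prob ?P ?bad = measure_pmf.prob ?P (- ?bad)"
    using measure_pmf.prob_compl[of ?bad ?P] by (simp add: Compl_eq_Diff_UNIV)
  also have "\<dots> \<le> measure_pmf.prob ?P {Xin. lp_recovers_ground_truth n d Xin}"
  proof (rule measure_pmf.finite_measure_mono_AE)
    show "AE Xin in ?P. Xin \<in> - ?bad \<longrightarrow> Xin \<in> {Xin. lp_recovers_ground_truth n d Xin}"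
      using balanced_recovers[OF supp n p(1) r] by (auto simp: AE_measure_pmf_iff)
  qed simp
  finally show ?thesis
    using prob_not_balanced_le[of p n ?\<epsilon> d] p n by simp
qed

theorem theorem1:
  fixes p_true :: real and d :: "nat \<Rightarrow> nat"
  assumes "0 \<le> p_true" and "p_true \<le> 1"
    and "\<And>n. n \<ge> 3 \<Longrightarrow> d n \<ge> 2"
    and "(\<lambda>n. real (d n)) \<in> o(\<lambda>n. (real n / ln (real n)) powr (1 / 4))"
    and "p_true > 0.585"
  shows "(\<lambda>n. measure_pmf.prob (random_corruption n (d n) p_true)
            {Xin. lp_recovers_ground_truth n (d n) Xin}) \<longlonglongrightarrow> 1"
proof -
  let ?prob = "\<lambda>n. measure_pmf.prob (random_corruption n (d n) p_true)
    {Xin. lp_recovers_ground_truth n (d n) Xin}"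
  define c where "c = 2 * ((2 * p_true - 1) / 20)\<^sup>2"
  have p: "1 / 2 < p_true" and c: "c > 0"
    using assms(5) by (auto simp: c_def)
  \<comment> \<open>The growth condition enters as the polynomial bound \<open>d n \<le> n\<close>, which the exponential decay beats.\<close>
  have "eventually (\<lambda>n. norm (real (d n)) \<le> 1 * norm ((real n / ln (real n)) powr (1 / 4))) at_top"
    using assms(4) by (rule landau_o.smallD) simp
  moreover have "eventually (\<lambda>n. (real n / ln (real n)) powr (1 / 4) \<le> real n) at_top"
    by real_asymp
  ultimately have d_le: "eventually (\<lambda>n. real (d n) \<le> real n) at_top"
    by eventually_elim simp
  have lower: "eventually (\<lambda>n. 1 - 4 * real n ^ 4 * exp (- c * (real n - 2)) \<le> ?prob n) at_top"
    using d_le eventually_ge_at_top[of 3]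
  proof eventually_elim
    fix n assume d: "real (d n) \<le> real n" and n: "3 \<le> n"
    have "(real n)\<^sup>2 * (real (d n))\<^sup>2 \<le> (real n)\<^sup>2 * (real n)\<^sup>2"
      using d by (intro mult_left_mono power_mono) auto
    also have "\<dots> = real n ^ 4"
      by (simp flip: power_add)
    finally have "(real n)\<^sup>2 * (real (d n))\<^sup>2 * (4 * exp (- c * (real n - 2)))
        \<le> real n ^ 4 * (4 * exp (- c * (real n - 2)))"
      by (rule mult_right_mono) simp
    moreover have "1 - (real n)\<^sup>2 * (real (d n))\<^sup>2 * (4 * exp (- c * (real n - 2))) \<le> ?prob n"
      using prob_recovers_ge[OF p assms(2) n, of "d n"] assms(3)[OF n] by (simp add: c_def)
    ultimately show "1 - 4 * real n ^ 4 * exp (- c * (real n - 2)) \<le> ?prob n"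
      by linarith
  qed
  have lim: "(\<lambda>n. 1 - 4 * real n ^ 4 * exp (- c * (real n - 2))) \<longlonglongrightarrow> 1"
    using c by real_asymp
  have upper: "eventually (\<lambda>n. ?prob n \<le> 1) at_top"
    by (simp add: measure_pmf.prob_le_1)
  show ?thesis
    by (rule tendsto_sandwich[OF lower upper lim tendsto_const])
qed

end
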